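(* Let $m\ge 2$ and let $v,w\in(R_\infty)^m$, where $R_\infty=(\mathbb{Z},* )$ with $a*b=2b-a$. The following are equivalent. (1) There exists a virtual pure $m$-braid $\beta\in VP_m$ such that $v\cdot\beta=w$. (2) $d(v)=d(w)$ and $M^*(v)=M^*(w)$.
   Context: The universal dihedral quandle $R_\infty$ is the set $\mathbb{Z}$ with operation $a*b=2b-a$; thus $(R_\infty)^m=\mathbb{Z}^m$ as a set. $VB_m$ is the virtual $m$-braid group with standard generators $\sigma_1,\dots,\sigma_{m-1}$ (classical crossings) and $\tau_1,\dots,\tau_{m-1}$ (virtual crossings), subject to the braid relations for the $\sigma_i$, the symmetric group relations for the $\tau_i$ (in particular $\tau_i^2=1$), and the mixed relations $\sigma_i\tau_j=\tau_j\sigma_i$ for $|i-j|\ge2$ and $\tau_i\tau_{i+1}\sigma_i=\sigma_{i+1}\tau_i\tau_{i+1}$. The Hurwitz action is the right action of $VB_m$ on $\mathbb{Z}^m$ given by $(a_1,\dots,a_m)\cdot\sigma_i=(a_1,\dots,a_{i-1},a_{i+1},2a_{i+1}-a_i,a_{i+2},\dots,a_m)$ and $(a_1,\dots,a_m)\cdot\tau_i=(a_1,\dots,a_{i-1},a_{i+1},a_i,a_{i+2},\dots,a_m)$. Each $\beta\in VB_m$ has an associated permutation $\pi_\beta\in S_m$: the string of $\beta$ starting at the $k$th top point ends at the $\pi_\beta(k)$th bottom point (so $\pi_{\sigma_i}=\pi_{\tau_i}=(i\ i+1)$). The virtual pure $m$-braid group is $VP_m=\{\beta\in VB_m\mid\pi_\beta=e\}$,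 acting on $\mathbb{Z}^m$ by restriction. For $v=(a_1,\dots,a_m)\in\mathbb{Z}^m$: $v$ is trivial if $a_1=\dots=a_m$, and nontrivial otherwise. $d(v)=0$ if $v$ is trivial, and $d(v)=\gcd\{a_i-a_j\mid 1\le i,j\le m\}>0$ if $v$ is nontrivial. $M^*(v)=(a_1,\dots,a_m)\in(\mathbb{Z}/2d(v)\mathbb{Z})^m$ is the ordered $m$-tuple of congruence classes of the $a_i$ modulo $2d(v)$, with the convention that if $d(v)=0$, the class of $a_i$ is the integer $a_i$ itself. *)

theory Defs
  imports
    "HOL-Algebra.Group"
    "HOL-Number_Theory.Cong"
    "HOL-Combinatorics.Transposition"
begin

section \<open>Groups given by generators and relations\<close>

datatype 'g letter = Gen 'g | GenInv 'g

definition words :: "'g set \<Rightarrow> 'g letter list set" where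
  "words S = lists (Gen ` S \<union> GenInv ` S)"

text \<open>A pair \<open>(r, s)\<close> in \<open>R\<close> stands for the relation \<open>r = s\<close>.\<close>

inductive pres_eq ::
  "'g set \<Rightarrow> ('g letter list \<times> 'g letter list) set \<Rightarrow> 'g letter list \<Rightarrow> 'g letter list \<Rightarrow> bool"
  for S R where
  refl: "u \<in> words S \<Longrightarrow> pres_eq S R u u"
| sym: "pres_eq S R u v \<Longrightarrow> pres_eq S R v u"
| trans: "pres_eq S R u v \<Longrightarrow> pres_eq S R v w \<Longrightarrow> pres_eq S R u w"
| cancel_right: "u \<in> words S \<Longrightarrow> v \<in> words S \<Longrightarrow> x \<in> S \<Longrightarrow>
    pres_eq S R (u @ [Gen x, GenInv x] @ v) (u @ v)"
| cancel_left: "u \<in> words S \<Longrightarrow> v \<in> words S \<Longrightarrow> x \<in> S \<Longrightarrow>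
    pres_eq S R (u @ [GenInv x, Gen x] @ v) (u @ v)"
| relator: "u \<in> words S \<Longrightarrow> v \<in> words S \<Longrightarrow> (r, s) \<in> R \<Longrightarrow>
    pres_eq S R (u @ r @ v) (u @ s @ v)"

definition pres_rel ::
  "'g set \<Rightarrow> ('g letter list \<times> 'g letter list) set \<Rightarrow> ('g letter list \<times> 'g letter list) set" where
  "pres_rel S R = {(u, v). pres_eq S R u v}"

definition presented_group ::
  "'g set \<Rightarrow> ('g letter list \<times> 'g letter list) set \<Rightarrow> 'g letter list set monoid" where
  "presented_group S R =
    \<lparr>carrier = words S // pres_rel S R,
     monoid.mult = (\<lambda>A B. \<Union>a\<in>A. \<Union>b\<in>B. pres_rel S R `` {a @ b}),
     monoid.one = pres_rel S R `` {[]}\<rparr>"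

lemma words_simps [simp]:
  "[] \<in> words S"
  "u @ v \<in> words S \<longleftrightarrow> u \<in> words S \<and> v \<in> words S"
  "Gen x # u \<in> words S \<longleftrightarrow> x \<in> S \<and> u \<in> words S"
  "GenInv x # u \<in> words S \<longleftrightarrow> x \<in> S \<and> u \<in> words S"
  by (auto simp: words_def)

lemma pres_eq_words:
  assumes "R \<subseteq> words S \<times> words S" and "pres_eq S R u v"
  shows "u \<in> words S \<and> v \<in> words S"
  using assms(2) by induction (use assms(1) in auto)

lemma equiv_pres_rel:
  assumes "R \<subseteq> words S \<times> words S"
  shows "equiv (words S) (pres_rel S R)"
proof (rule equivI)
  show "pres_rel S R \<subseteq> words S \<times> words S"
    using pres_eq_words[OF assms] by (auto simp: pres_rel_def)
  show "refl_on (words S) (pres_rel S R)"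
    by (auto simp: refl_on_def pres_rel_def intro: pres_eq.refl)
  show "Relation.sym (pres_rel S R)"
    unfolding sym_def pres_rel_def by (blast intro: pres_eq.sym)
  show "Relation.trans (pres_rel S R)"
    unfolding trans_def pres_rel_def by (blast intro: pres_eq.trans)
qed

lemma pres_eq_ctxt:
  assumes "pres_eq S R u v" "p \<in> words S" "q \<in> words S"
  shows "pres_eq S R (p @ u @ q) (p @ v @ q)"
  using assms(1)
proof induction
  case (refl u)
  then show ?case using assms by (auto intro: pres_eq.refl)
next
  case (sym u v)
  show ?case by (rule pres_eq.sym) (rule sym.IH)
next
  case (trans u v w)
  show ?case by (rule pres_eq.trans) (rule trans.IH)+
next
  case (cancel_right u v x)
  then show ?case using pres_eq.cancel_right[of "p @ u" S "v @ q" x R] assms by auto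
next
  case (cancel_left u v x)
  then show ?case using pres_eq.cancel_left[of "p @ u" S "v @ q" x R] assms by auto
next
  case (relator u v r s)
  then show ?case using pres_eq.relator[of "p @ u" S "v @ q" r s R] assms by auto
qed

lemma pres_eq_append:
  assumes R: "R \<subseteq> words S \<times> words S" and "pres_eq S R u u'" "pres_eq S R v v'"
  shows "pres_eq S R (u @ v) (u' @ v')"
proof -
  have w: "u \<in> words S" "u' \<in> words S" "v \<in> words S" "v' \<in> words S"
    using assms pres_eq_words[OF R] by auto
  have "pres_eq S R (u @ v) (u' @ v)"
    using pres_eq_ctxt[OF assms(2), of "[]" v] w by simp
  moreover have "pres_eq S R (u' @ v) (u' @ v')"
    using pres_eq_ctxt[OF assms(3), of u' "[]"] w by simp
  ultimately show ?thesis by (rule pres_eq.trans)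
qed

lemma mult_presented_group:
  assumes R: "R \<subseteq> words S \<times> words S" and "u \<in> words S" "v \<in> words S"
  shows "(pres_rel S R `` {u}) \<otimes>\<^bsub>presented_group S R\<^esub> (pres_rel S R `` {v})
    = pres_rel S R `` {u @ v}"
proof -
  have eq: "pres_rel S R `` {a @ b} = pres_rel S R `` {u @ v}"
    if "a \<in> pres_rel S R `` {u}" "b \<in> pres_rel S R `` {v}" for a b
  proof -
    have "(u @ v, a @ b) \<in> pres_rel S R"
      using that pres_eq_append[OF R] by (auto simp: pres_rel_def)
    then show ?thesis using equiv_class_eq[OF equiv_pres_rel[OF R]] by auto
  qed
  then have "(\<Union>a\<in>pres_rel S R `` {u}. \<Union>b\<in>pres_rel S R `` {v}. pres_rel S R `` {a @ b})
      = (\<Union>a\<in>pres_rel S R `` {u}. \<Union>b\<in>pres_rel S R `` {v}. pres_rel S R `` {u @ v})"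
    by (intro SUP_cong[OF HOL.refl])
  also have "\<dots> = pres_rel S R `` {u @ v}"
  proof -
    have "u \<in> pres_rel S R `` {u}" "v \<in> pres_rel S R `` {v}"
      using assms by (auto simp: pres_rel_def intro: pres_eq.refl)
    then show ?thesis by blast
  qed
  finally show ?thesis by (simp add: presented_group_def)
qed

fun inv_letter :: "'g letter \<Rightarrow> 'g letter" where
  "inv_letter (Gen x) = GenInv x"
| "inv_letter (GenInv x) = Gen x"

lemma inverse_word:
  assumes "u \<in> words S"
  shows "rev (map inv_letter u) \<in> words S \<and> pres_eq S R (rev (map inv_letter u) @ u) []"
  using assms
proof (induction u)
  case Nil
  then show ?case by (auto intro: pres_eq.refl)
next
  case (Cons a u)
  let ?u = "rev (map inv_letter u)"
  have u: "u \<in> words S" using Cons.prems by (cases a) auto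
  have IH: "?u \<in> words S" "pres_eq S R (?u @ u) []" using Cons.IH u by auto
  have "pres_eq S R (?u @ [inv_letter a, a] @ u) (?u @ u)"
  proof (cases a)
    case (Gen x)
    then show ?thesis
      using Cons.prems IH u pres_eq.cancel_left[of ?u S u x R] by simp
  next
    case (GenInv x)
    then show ?thesis
      using Cons.prems IH u pres_eq.cancel_right[of ?u S u x R] by simp
  qed
  then have "pres_eq S R (?u @ [inv_letter a, a] @ u) []"
    using IH(2) by (rule pres_eq.trans)
  moreover have "?u @ [inv_letter a] \<in> words S"
    using Cons.prems IH by (cases a) auto
  ultimately show ?case by simp
qed

lemma group_presented_group:
  assumes R: "R \<subseteq> words S \<times> words S"
  shows "group (presented_group S R)"
proof (rule groupI)
  let ?G = "presented_group S R"
  have car: "carrier ?G = words S // pres_rel S R" and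
    one: "\<one>\<^bsub>?G\<^esub> = pres_rel S R `` {[]}" by (simp_all add: presented_group_def)
  note mult = mult_presented_group[OF R]
  show "\<one>\<^bsub>?G\<^esub> \<in> carrier ?G" by (auto simp: car one intro: quotientI)
  fix x assume "x \<in> carrier ?G"
  then obtain u where u: "u \<in> words S" "x = pres_rel S R `` {u}"
    by (auto simp: car elim: quotientE)
  show "\<one>\<^bsub>?G\<^esub> \<otimes>\<^bsub>?G\<^esub> x = x" using u by (simp add: one mult)
  show "\<exists>y\<in>carrier ?G. y \<otimes>\<^bsub>?G\<^esub> x = \<one>\<^bsub>?G\<^esub>"
  proof (rule bexI)
    let ?u = "rev (map inv_letter u)"
    have i: "?u \<in> words S" "pres_eq S R (?u @ u) []" using inverse_word u by auto
    show "pres_rel S R `` {?u} \<in> carrier ?G" using i by (auto simp: car intro: quotientI)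
    have "(?u @ u, []) \<in> pres_rel S R" using i by (simp add: pres_rel_def)
    then show "(pres_rel S R `` {?u}) \<otimes>\<^bsub>?G\<^esub> x = \<one>\<^bsub>?G\<^esub>"
      using i u equiv_class_eq[OF equiv_pres_rel[OF R]] by (simp add: mult one)
  qed
  fix y assume "y \<in> carrier ?G"
  then obtain v where v: "v \<in> words S" "y = pres_rel S R `` {v}"
    by (auto simp: car elim: quotientE)
  show "x \<otimes>\<^bsub>?G\<^esub> y \<in> carrier ?G" using u v by (auto simp: mult car intro: quotientI)
  fix z assume "z \<in> carrier ?G"
  then obtain w where w: "w \<in> words S" "z = pres_rel S R `` {w}"
    by (auto simp: car elim: quotientE)
  show "x \<otimes>\<^bsub>?G\<^esub> y \<otimes>\<^bsub>?G\<^esub> z = x \<otimes>\<^bsub>?G\<^esub> (y \<otimes>\<^bsub>?G\<^esub> z)"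
    using u v w by (simp add: mult)
qed

section \<open>The virtual braid group\<close>

datatype vgen = \<sigma> nat | \<tau> nat

definition vgens :: "nat \<Rightarrow> vgen set" where
  "vgens m = \<sigma> ` {1..<m} \<union> \<tau> ` {1..<m}"

abbreviation sig :: "nat \<Rightarrow> vgen letter" where "sig i \<equiv> Gen (\<sigma> i)"
abbreviation tau :: "nat \<Rightarrow> vgen letter" where "tau i \<equiv> Gen (\<tau> i)"

definition vrels :: "nat \<Rightarrow> (vgen letter list \<times> vgen letter list) set" where
  "vrels m =
     {([sig i, sig j], [sig j, sig i]) | i j. i \<in> {1..<m} \<and> j \<in> {1..<m} \<and> (i + 2 \<le> j \<or> j + 2 \<le> i)}
   \<union> {([sig i, sig (i+1), sig i], [sig (i+1), sig i, sig (i+1)]) | i. 1 \<le> i \<and> i + 1 < m}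
   \<union> {([tau i, tau j], [tau j, tau i]) | i j. i \<in> {1..<m} \<and> j \<in> {1..<m} \<and> (i + 2 \<le> j \<or> j + 2 \<le> i)}
   \<union> {([tau i, tau (i+1), tau i], [tau (i+1), tau i, tau (i+1)]) | i. 1 \<le> i \<and> i + 1 < m}
   \<union> {([tau i, tau i], []) | i. i \<in> {1..<m}}
   \<union> {([sig i, tau j], [tau j, sig i]) | i j. i \<in> {1..<m} \<and> j \<in> {1..<m} \<and> (i + 2 \<le> j \<or> j + 2 \<le> i)}
   \<union> {([tau i, tau (i+1), sig i], [sig (i+1), tau i, tau (i+1)]) | i. 1 \<le> i \<and> i + 1 < m}"

definition VB :: "nat \<Rightarrow> vgen letter list set monoid" where
  "VB m = presented_group (vgens m) (vrels m)"

abbreviation braid_of :: "nat \<Rightarrow> vgen letter list \<Rightarrow> vgen letter list set" where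
  "braid_of m u \<equiv> pres_rel (vgens m) (vrels m) `` {u}"

lemma vgens_iff [simp]: "\<sigma> i \<in> vgens m \<longleftrightarrow> 1 \<le> i \<and> i < m" "\<tau> i \<in> vgens m \<longleftrightarrow> 1 \<le> i \<and> i < m"
  by (auto simp: vgens_def)

lemma vrels_words: "vrels m \<subseteq> words (vgens m) \<times> words (vgens m)"
  by (auto simp: vrels_def)

lemma group_VB: "group (VB m)"
  unfolding VB_def by (rule group_presented_group[OF vrels_words])

lemma carrier_VB: "\<beta> \<in> carrier (VB m) \<longleftrightarrow> (\<exists>u\<in>words (vgens m). \<beta> = braid_of m u)"
  by (auto simp: VB_def presented_group_def quotient_def)

lemma mult_VB:
  "u \<in> words (vgens m) \<Longrightarrow> v \<in> words (vgens m) \<Longrightarrow>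
    braid_of m u \<otimes>\<^bsub>VB m\<^esub> braid_of m v = braid_of m (u @ v)"
  unfolding VB_def by (rule mult_presented_group[OF vrels_words])

section \<open>Associated permutation\<close>

fun letter_perm :: "vgen letter \<Rightarrow> nat \<Rightarrow> nat" where
  "letter_perm (Gen (\<sigma> i)) = transpose i (i + 1)"
| "letter_perm (GenInv (\<sigma> i)) = transpose i (i + 1)"
| "letter_perm (Gen (\<tau> i)) = transpose i (i + 1)"
| "letter_perm (GenInv (\<tau> i)) = transpose i (i + 1)"

text \<open>Braid words are read from top to bottom, so the string starting at \<open>k\<close> meets the
  first letter first.\<close>

definition word_perm :: "vgen letter list \<Rightarrow> nat \<Rightarrow> nat" where
  "word_perm u k = fold letter_perm u k"

text \<open>\<open>word_perm\<close> is constant on each element of \<open>carrier (VB m)\<close>, so the image below is a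
  singleton; see \<open>braid_perm_eq\<close>.\<close>

definition braid_perm :: "vgen letter list set \<Rightarrow> nat \<Rightarrow> nat" where
  "braid_perm \<beta> = the_elem (word_perm ` \<beta>)"

definition VP :: "nat \<Rightarrow> vgen letter list set set" where
  "VP m = {\<beta> \<in> carrier (VB m). braid_perm \<beta> = id}"

lemma the_elem_braid_of:
  assumes u: "u \<in> words (vgens m)"
    and f: "\<And>u v. pres_eq (vgens m) (vrels m) u v \<Longrightarrow> f u = f v"
  shows "the_elem (f ` braid_of m u) = f u"
proof -
  have "u \<in> braid_of m u" using u by (auto simp: pres_rel_def intro: pres_eq.refl)
  moreover have "f v = f u" if "v \<in> braid_of m u" for v
    using that f by (auto simp: pres_rel_def)
  ultimately have "f ` braid_of m u = {f u}" by blast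
  then show ?thesis by simp
qed

lemma word_perm_pres_eq:
  "pres_eq (vgens m) (vrels m) u v \<Longrightarrow> word_perm u = word_perm v"
proof (induction rule: pres_eq.induct)
  case (cancel_right u v x)
  then show ?case by (cases x) (auto simp: word_perm_def fun_eq_iff)
next
  case (cancel_left u v x)
  then show ?case by (cases x) (auto simp: word_perm_def fun_eq_iff)
next
  case (relator u v r s)
  have three: "k = i \<or> k = Suc i \<or> k = Suc (Suc i) \<or> k \<notin> {i, Suc i, Suc (Suc i)}" for i k :: nat
    by auto
  have far: "k = i \<or> k = Suc i \<or> k = j \<or> k = Suc j \<or> k \<notin> {i, Suc i, j, Suc j}" for i j k :: nat
    by auto
  have braid: "transpose i (Suc i) (transpose (Suc i) (Suc (Suc i)) (transpose i (Suc i) k)) =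
      transpose (Suc i) (Suc (Suc i)) (transpose i (Suc i) (transpose (Suc i) (Suc (Suc i)) k))" for i k :: nat
    using three[of k i] by (elim disjE) (simp_all add: transpose_def)
  have comm: "transpose i (Suc i) (transpose j (Suc j) k) = transpose j (Suc j) (transpose i (Suc i) k)"
    if "Suc (Suc i) \<le> j \<or> Suc (Suc j) \<le> i" for i j k :: nat
    using that far[of k i j] by (elim disjE) (simp_all add: transpose_def)
  have "fold letter_perm r k = fold letter_perm s k" for k
    using relator(3) unfolding vrels_def
    by (elim UnE CollectE exE conjE) (simp_all add: braid, (metis comm)+)
  then show ?case by (auto simp: word_perm_def fun_eq_iff)
qed simp_all

lemma braid_perm_eq: "u \<in> words (vgens m) \<Longrightarrow> braid_perm (braid_of m u) = word_perm u"
  unfolding braid_perm_def by (intro the_elem_braid_of word_perm_pres_eq)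

section \<open>The Hurwitz action on powers of the universal dihedral quandle\<close>

definition dihedral_op :: "int \<Rightarrow> int \<Rightarrow> int" (infixl "\<rhd>" 70) where
  "a \<rhd> b = 2 * b - a"

text \<open>An \<open>m\<close>-tuple is a function on \<open>{1..m}\<close>, set to \<open>undefined\<close> outside that range.\<close>

abbreviation R_inf_pow :: "nat \<Rightarrow> (nat \<Rightarrow> int) set" where
  "R_inf_pow m \<equiv> {1..m} \<rightarrow>\<^sub>E UNIV"

text \<open>Since \<open>(a \<rhd> b) \<rhd> b = a\<close>, the inverse of \<open>(a, b) \<mapsto> (b, a \<rhd> b)\<close> is
  \<open>(a, b) \<mapsto> (b \<rhd> a, a)\<close>.\<close>

fun letter_act :: "vgen letter \<Rightarrow> (nat \<Rightarrow> int) \<Rightarrow> (nat \<Rightarrow> int)" where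
  "letter_act (Gen (\<sigma> i)) a = a(i := a (i+1), i+1 := a i \<rhd> a (i+1))"
| "letter_act (GenInv (\<sigma> i)) a = a(i := a (i+1) \<rhd> a i, i+1 := a i)"
| "letter_act (Gen (\<tau> i)) a = a(i := a (i+1), i+1 := a i)"
| "letter_act (GenInv (\<tau> i)) a = a(i := a (i+1), i+1 := a i)"

definition word_act :: "(nat \<Rightarrow> int) \<Rightarrow> vgen letter list \<Rightarrow> (nat \<Rightarrow> int)" where
  "word_act a u = fold letter_act u a"

text \<open>As for \<open>braid_perm\<close>, the image is a singleton; see \<open>hurwitz_eq\<close>.\<close>

definition hurwitz :: "(nat \<Rightarrow> int) \<Rightarrow> vgen letter list set \<Rightarrow> (nat \<Rightarrow> int)" (infixl "\<cdot>" 70) where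
  "a \<cdot> \<beta> = the_elem (word_act a ` \<beta>)"

lemma word_act_pres_eq:
  "pres_eq (vgens m) (vrels m) u v \<Longrightarrow> word_act a u = word_act a v"
proof (induction arbitrary: a rule: pres_eq.induct)
  case (cancel_right u v x)
  then show ?case by (cases x) (auto simp: word_act_def dihedral_op_def)
next
  case (cancel_left u v x)
  then show ?case by (cases x) (auto simp: word_act_def dihedral_op_def)
next
  case (relator u v r s)
  have braid: "fold letter_act [Gen (f i), Gen (g (Suc i)), Gen (h i)] b =
      fold letter_act [Gen (h (Suc i)), Gen (g i), Gen (f (Suc i))] b"
    if "f = \<sigma> \<and> g = \<sigma> \<and> h = \<sigma> \<or> f = \<tau> \<and> g = \<tau>" "h = \<sigma> \<or> h = \<tau>" for f g h i and b :: "nat \<Rightarrow> int"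
  proof
    fix k
    have "k = i \<or> k = Suc i \<or> k = Suc (Suc i) \<or> k \<notin> {i, Suc i, Suc (Suc i)}" by auto
    then show "fold letter_act [Gen (f i), Gen (g (Suc i)), Gen (h i)] b k =
      fold letter_act [Gen (h (Suc i)), Gen (g i), Gen (f (Suc i))] b k"
      using that by (elim disjE conjE) (simp_all add: dihedral_op_def)
  qed
  have comm: "fold letter_act [Gen (f i), Gen (g j)] b = fold letter_act [Gen (g j), Gen (f i)] b"
    if "i + 2 \<le> j \<or> j + 2 \<le> i" "f = \<sigma> \<or> f = \<tau>" "g = \<sigma> \<or> g = \<tau>" for f g i j and b :: "nat \<Rightarrow> int"
  proof
    fix k
    have ne: "i \<noteq> j" "Suc i \<noteq> j" "i \<noteq> Suc j" "j \<noteq> i" "j \<noteq> Suc i" "Suc j \<noteq> i" using that(1) by auto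
    have "k = i \<or> k = Suc i \<or> k = j \<or> k = Suc j \<or> k \<notin> {i, Suc i, j, Suc j}" by auto
    then show "fold letter_act [Gen (f i), Gen (g j)] b k = fold letter_act [Gen (g j), Gen (f i)] b k"
      using that(2,3) ne by (elim disjE) (simp_all add: dihedral_op_def)
  qed
  have invol: "fold letter_act [Gen (\<tau> i), Gen (\<tau> i)] b = fold letter_act [] b" for i and b :: "nat \<Rightarrow> int"
    by (auto simp: fun_eq_iff)
  have "fold letter_act r b = fold letter_act s b" for b
    using relator(3) unfolding vrels_def
    by (elim UnE CollectE exE conjE Pair_inject)
      (simp_all only: braid invol Suc_eq_plus1[symmetric] simp_thms,
       (rule comm[where f = \<sigma> and g = \<sigma>] comm[where f = \<tau> and g = \<tau>]
          comm[where f = \<sigma> and g = \<tau>]; simp)+)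
  then show ?case by (auto simp: word_act_def)
qed simp_all

lemma hurwitz_eq: "u \<in> words (vgens m) \<Longrightarrow> a \<cdot> braid_of m u = word_act a u"
  unfolding hurwitz_def by (intro the_elem_braid_of word_act_pres_eq)

lemma word_act_closed:
  "u \<in> words (vgens m) \<Longrightarrow> a \<in> R_inf_pow m \<Longrightarrow> word_act a u \<in> R_inf_pow m"
proof (induction u arbitrary: a)
  case Nil
  then show ?case by (simp add: word_act_def)
next
  case (Cons l u)
  have u: "u \<in> words (vgens m)" using Cons.prems by (cases l) auto
  have "letter_act l a \<in> R_inf_pow m"
    using Cons.prems by (cases l rule: letter_perm.cases) (auto simp: PiE_def extensional_def)
  then show ?case using Cons.IH[OF u] by (simp add: word_act_def)
qed

lemma hurwitz_closed: "\<beta> \<in> carrier (VB m) \<Longrightarrow> a \<in> R_inf_pow m \<Longrightarrow> a \<cdot> \<beta> \<in> R_inf_pow m"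
proof -
  assume \<beta>: "\<beta> \<in> carrier (VB m)" and a: "a \<in> R_inf_pow m"
  from \<beta> obtain u where u: "u \<in> words (vgens m)" "\<beta> = braid_of m u"
    unfolding carrier_VB by blast
  show "a \<cdot> \<beta> \<in> R_inf_pow m"
    unfolding u(2) hurwitz_eq[OF u(1)] by (rule word_act_closed[OF u(1) a])
qed

lemma hurwitz_one: "a \<cdot> \<one>\<^bsub>VB m\<^esub> = a"
proof -
  have "\<one>\<^bsub>VB m\<^esub> = braid_of m []" by (simp add: VB_def presented_group_def)
  then show ?thesis by (simp add: hurwitz_eq word_act_def)
qed

lemma hurwitz_mult:
  assumes "\<beta> \<in> carrier (VB m)" "\<gamma> \<in> carrier (VB m)"
  shows "a \<cdot> (\<beta> \<otimes>\<^bsub>VB m\<^esub> \<gamma>) = a \<cdot> \<beta> \<cdot> \<gamma>"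
proof -
  obtain u v where u: "u \<in> words (vgens m)" "\<beta> = braid_of m u"
    and v: "v \<in> words (vgens m)" "\<gamma> = braid_of m v"
    using assms unfolding carrier_VB by blast
  have uv: "u @ v \<in> words (vgens m)" using u v by simp
  show ?thesis
    unfolding u(2) v(2) mult_VB[OF u(1) v(1)] hurwitz_eq[OF uv] hurwitz_eq[OF u(1)] hurwitz_eq[OF v(1)]
    by (simp add: word_act_def)
qed

lemma subgroup_VP: "subgroup (VP m) (VB m)"
proof -
  interpret group "VB m" by (rule group_VB)
  have one: "\<one>\<^bsub>VB m\<^esub> = braid_of m []" by (simp add: VB_def presented_group_def)
  have p1: "braid_perm \<one>\<^bsub>VB m\<^esub> = id"
    unfolding one by (simp add: braid_perm_eq word_perm_def fun_eq_iff)
  have pm: "braid_perm (\<beta> \<otimes>\<^bsub>VB m\<^esub> \<gamma>) = braid_perm \<gamma> \<circ> braid_perm \<beta>"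
    if bc: "\<beta> \<in> carrier (VB m)" "\<gamma> \<in> carrier (VB m)" for \<beta> \<gamma>
  proof -
    obtain u v where u: "u \<in> words (vgens m)" "\<beta> = braid_of m u"
      and v: "v \<in> words (vgens m)" "\<gamma> = braid_of m v"
      using bc unfolding carrier_VB by blast
    have uv: "u @ v \<in> words (vgens m)" using u v by simp
    show ?thesis
      unfolding u(2) v(2) mult_VB[OF u(1) v(1)] braid_perm_eq[OF uv] braid_perm_eq[OF u(1)]
        braid_perm_eq[OF v(1)]
      by (simp add: word_perm_def fun_eq_iff)
  qed
  show ?thesis
  proof (rule subgroupI)
    show "VP m \<subseteq> carrier (VB m)" by (auto simp: VP_def)
    show "VP m \<noteq> {}" using p1 one_closed unfolding VP_def by blast
    fix \<beta> assume "\<beta> \<in> VP m"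
    then have \<beta>: "\<beta> \<in> carrier (VB m)" "braid_perm \<beta> = id" unfolding VP_def by blast+
    have "braid_perm (inv\<^bsub>VB m\<^esub> \<beta>) = id"
      using pm[OF \<beta>(1) inv_closed[OF \<beta>(1)]] unfolding r_inv[OF \<beta>(1)] p1 \<beta>(2) by simp
    then show "inv\<^bsub>VB m\<^esub> \<beta> \<in> VP m" using inv_closed[OF \<beta>(1)] unfolding VP_def by blast
    fix \<gamma> assume "\<gamma> \<in> VP m"
    then have \<gamma>: "\<gamma> \<in> carrier (VB m)" "braid_perm \<gamma> = id" unfolding VP_def by blast+
    show "\<beta> \<otimes>\<^bsub>VB m\<^esub> \<gamma> \<in> VP m"
      using m_closed[OF \<beta>(1) \<gamma>(1)] pm[OF \<beta>(1) \<gamma>(1)] \<beta>(2) \<gamma>(2) unfolding VP_def by simp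
  qed
qed

section \<open>The invariants\<close>

definition trivial_tuple :: "nat \<Rightarrow> (nat \<Rightarrow> int) \<Rightarrow> bool" where
  "trivial_tuple m v \<longleftrightarrow> (\<forall>i\<in>{1..m}. \<forall>j\<in>{1..m}. v i = v j)"

definition d :: "nat \<Rightarrow> (nat \<Rightarrow> int) \<Rightarrow> int" where
  "d m v = (if trivial_tuple m v then 0
            else Gcd {v i - v j | i j. i \<in> {1..m} \<and> j \<in> {1..m}})"

text \<open>A class modulo \<open>n\<close> is a set of integers; for \<open>n = 0\<close> it is the singleton \<open>{a}\<close>, which
  stands for the integer \<open>a\<close> itself.\<close>

definition residue_class :: "int \<Rightarrow> int \<Rightarrow> int set" where
  "residue_class n a = {x. [x = a] (mod n)}"

definition M_star :: "nat \<Rightarrow> (nat \<Rightarrow> int) \<Rightarrow> nat \<Rightarrow> int set" where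
  "M_star m v = (\<lambda>i\<in>{1..m}. residue_class (2 * d m v) (v i))"

lemma d_pos: "\<not> trivial_tuple m v \<Longrightarrow> d m v > 0"
proof -
  assume nt: "\<not> trivial_tuple m v"
  then obtain i j where ij: "i \<in> {1..m}" "j \<in> {1..m}" "v i \<noteq> v j"
    by (auto simp: trivial_tuple_def)
  let ?D = "{v i - v j | i j. i \<in> {1..m} \<and> j \<in> {1..m}}"
  have "v i - v j \<in> ?D" using ij by blast
  then have "Gcd ?D dvd v i - v j" by (rule Gcd_dvd)
  then have "Gcd ?D \<noteq> 0" using ij(3) by (metis dvd_0_left eq_iff_diff_eq_0)
  moreover have "Gcd ?D \<ge> 0" by (rule Gcd_int_greater_eq_0)
  ultimately show ?thesis using nt by (simp only: d_def if_False)
qed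

lemma residue_class_0: "residue_class 0 a = {a}"
  by (auto simp: residue_class_def cong_def)

end

theory Submission
  imports Defs
begin

text \<open>
  Write \<open>s\<close> for the permutation of a braid. The Hurwitz action replaces \<open>a k\<close> by either \<open>a k\<close>
  or \<open>2 * a j - a k\<close> at position \<open>s k\<close>, which is the same class modulo \<open>2 * d\<close>; so \<open>d\<close> and, for
  pure braids, \<open>M_star\<close> are invariant.
  Conversely, conjugating \<open>\<sigma> i \<tau> i\<close> by virtual crossings realises every reflection
  \<open>a i := 2 * a j - a i\<close> with \<open>i \<noteq> j\<close> by a pure braid. If the entries lie in an interval and one
  of them lies strictly inside it, then reflecting in that entry all entries at the nearer end shrinks
  the interval. Hence every tuple can be moved to one with entries in \<open>{L, L + d}\<close>.
  Reflecting all entries equal to \<open>L\<close> in one equal to \<open>L + d\<close> moves \<open>L\<close> to \<open>L + d\<close>, so two tuples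
  with the same invariants can be moved to the same set \<open>{L, L + d}\<close>, where the classes modulo
  \<open>2 * d\<close> determine the entries.
\<close>

section \<open>Invariance\<close>

text \<open>In a trivial tuple all differences vanish, so their gcd is 0 anyway and the case split
  in \<open>d\<close> disappears.\<close>

lemma d_eq_Gcd: "d m v = Gcd {v i - v j | i j. i \<in> {1..m} \<and> j \<in> {1..m}}"
proof (cases "trivial_tuple m v")
  case True
  then have "{v i - v j | i j. i \<in> {1..m} \<and> j \<in> {1..m}} \<subseteq> {0}"
    unfolding trivial_tuple_def by fastforce
  then have "Gcd {v i - v j | i j. i \<in> {1..m} \<and> j \<in> {1..m}} = 0"
    by (rule Gcd_0_iff[THEN iffD2])
  then show ?thesis using True unfolding d_def by metis
qed (simp only: d_def if_False)

lemma d_nonneg: "d m v \<ge> 0"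
  unfolding d_eq_Gcd by (rule Gcd_int_greater_eq_0)

lemma dvd_d_iff: "x dvd d m v \<longleftrightarrow> (\<forall>i\<in>{1..m}. \<forall>j\<in>{1..m}. x dvd v i - v j)"
  unfolding d_eq_Gcd dvd_Gcd_iff Ball_def mem_Collect_eq by metis

lemma d_dvd: "i \<in> {1..m} \<Longrightarrow> j \<in> {1..m} \<Longrightarrow> d m v dvd v i - v j"
  using dvd_d_iff[of "d m v"] dvd_refl by metis

lemma words_Cons: "l # u \<in> words S \<longleftrightarrow> [l] \<in> words S \<and> u \<in> words S"
  by (cases l) auto

lemma letter_perm_closed:
  "[l] \<in> words (vgens m) \<Longrightarrow> k \<in> {1..m} \<Longrightarrow> letter_perm l k \<in> {1..m}"
  by (cases l rule: letter_perm.cases) (auto simp: transpose_def)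

lemma letter_perm_letter_perm: "letter_perm l (letter_perm l k) = k"
  by (cases l rule: letter_perm.cases) auto

lemma letter_act_inv_letter: "letter_act (inv_letter l) (letter_act l v) = v"
  by (cases l rule: letter_perm.cases) (auto simp: dihedral_op_def)

text \<open>The numbers \<open>2 * v j - v k\<close> and \<open>v k\<close> differ by
  \<open>2 * (v j - v k)\<close>; this factor 2 lifts the modulus from \<open>d\<close> to
  \<open>2 * d\<close>.\<close>

lemma letter_act_cong:
  assumes l: "[l] \<in> words (vgens m)" and k: "k \<in> {1..m}"
  shows "[letter_act l v (letter_perm l k) = v k] (mod (2 * d m v))"
proof -
  have "letter_act l v (letter_perm l k) = v k \<or>
      (\<exists>j\<in>{1..m}. letter_act l v (letter_perm l k) = 2 * v j - v k)"
  \<comment> \<open>The inverse of \<open>\<sigma> i\<close> reflects in the entry at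
    \<open>i\<close>, but \<open>\<sigma> i\<close> in the one at \<open>Suc i\<close>, so the
    witnesses for \<open>j\<close> differ.\<close>
  proof (cases "\<exists>i. l = GenInv (\<sigma> i)")
    case True
    then obtain i where "l = GenInv (\<sigma> i)" by blast
    then show ?thesis using l by (auto simp: transpose_def dihedral_op_def intro!: bexI[of _ i])
  next
    case False
    then show ?thesis using l k by (cases l rule: letter_perm.cases)
      (auto simp: transpose_def dihedral_op_def intro!: bexI[of _ "Suc _"])
  qed
  moreover have "2 * d m v dvd (2 * v j - v k) - v k" if "j \<in> {1..m}" for j
    using mult_dvd_mono[OF dvd_refl[of 2] d_dvd[OF that k]] by (simp add: algebra_simps)
  ultimately show ?thesis by (auto simp: cong_iff_dvd_diff)
qed

text \<open>A letter can only replace \<open>d\<close> by a multiple of it. Applying this to the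
  inverse letter as well gives equality, since \<open>d\<close> is nonnegative.\<close>

lemma d_letter_act:
  assumes "[l] \<in> words (vgens m)"
  shows "d m (letter_act l v) = d m v"
proof -
  have dvd: "d m v dvd d m (letter_act l v)" if l: "[l] \<in> words (vgens m)" for l v
    unfolding dvd_d_iff
  proof (intro ballI)
    fix i j assume ij: "i \<in> {1..m}" "j \<in> {1..m}"
    define i' j' where "i' = letter_perm l i" and "j' = letter_perm l j"
    have ij': "i' \<in> {1..m}" "j' \<in> {1..m}"
      using ij l letter_perm_closed by (auto simp only: i'_def j'_def)
    have c: "[letter_act l v i = v i'] (mod d m v)" "[letter_act l v j = v j'] (mod d m v)"
      using letter_act_cong[OF l ij'(1), of v, THEN cong_dvd_modulus, of "d m v"]
        letter_act_cong[OF l ij'(2), of v, THEN cong_dvd_modulus, of "d m v"]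
      by (simp_all add: i'_def j'_def letter_perm_letter_perm)
    show "d m v dvd letter_act l v i - letter_act l v j"
      using cong_diff[OF c] d_dvd[OF ij'] cong_dvd_iff by blast
  qed
  have "[inv_letter l] \<in> words (vgens m)"
    using assms by (cases l) auto
  from dvd[OF this, of "letter_act l v"] dvd[OF assms, of v] show ?thesis
    using d_nonneg by (simp add: letter_act_inv_letter zdvd_antisym_nonneg)
qed

lemma word_act_invariants:
  assumes "u \<in> words (vgens m)"
  shows "d m (word_act v u) = d m v \<and>
    (\<forall>k\<in>{1..m}. [word_act v u (word_perm u k) = v k] (mod (2 * d m v)))"
  using assms
proof (induction u arbitrary: v)
  case (Cons l u)
  have l: "[l] \<in> words (vgens m)" and u: "u \<in> words (vgens m)"
    using Cons.prems words_Cons by blast+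
  have word: "word_act v (l # u) = word_act (letter_act l v) u"
    "word_perm (l # u) k = word_perm u (letter_perm l k)" for k
    by (simp_all add: word_act_def word_perm_def)
  show ?case
    using Cons.IH[OF u, of "letter_act l v"] letter_act_cong[OF l, of _ v]
      letter_perm_closed[OF l] d_letter_act[OF l, of v]
    unfolding word by (metis cong_trans)
qed (simp_all add: word_act_def word_perm_def)

lemma residue_class_eq_iff: "residue_class n a = residue_class n b \<longleftrightarrow> [a = b] (mod n)"
  unfolding residue_class_def using cong_refl cong_sym cong_trans by blast

lemma M_star_eq_iff:
  assumes "d m v = d m w"
  shows "M_star m v = M_star m w \<longleftrightarrow> (\<forall>k\<in>{1..m}. [v k = w k] (mod (2 * d m v)))"
  using assms by (auto simp: M_star_def residue_class_eq_iff fun_eq_iff restrict_def)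

section \<open>Reflections realised by pure braids\<close>

text \<open>Phrased with words instead of classes, so that braids can be given as explicit lists of
  letters.\<close>

definition pure_reach :: "nat \<Rightarrow> (nat \<Rightarrow> int) \<Rightarrow> (nat \<Rightarrow> int) \<Rightarrow> bool" where
  "pure_reach m v w \<longleftrightarrow> (\<exists>u\<in>words (vgens m). word_perm u = id \<and> word_act v u = w)"

lemma pure_reach_iff_VP: "pure_reach m v w \<longleftrightarrow> (\<exists>\<beta>\<in>VP m. v \<cdot> \<beta> = w)"
proof
  assume "pure_reach m v w"
  then obtain u where "u \<in> words (vgens m)" "word_perm u = id" "word_act v u = w"
    unfolding pure_reach_def by blast
  then have "braid_of m u \<in> VP m" "v \<cdot> braid_of m u = w"
    unfolding VP_def mem_Collect_eq carrier_VB by (metis braid_perm_eq, metis hurwitz_eq)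
  then show "\<exists>\<beta>\<in>VP m. v \<cdot> \<beta> = w" by blast
next
  assume "\<exists>\<beta>\<in>VP m. v \<cdot> \<beta> = w"
  then obtain u where "u \<in> words (vgens m)" "braid_perm (braid_of m u) = id" "v \<cdot> braid_of m u = w"
    unfolding VP_def mem_Collect_eq carrier_VB by blast
  then show "pure_reach m v w"
    unfolding pure_reach_def by (metis braid_perm_eq hurwitz_eq)
qed

lemma pure_reach_refl: "pure_reach m v v"
  unfolding pure_reach_def by (rule bexI[of _ "[]"]) (auto simp: word_perm_def word_act_def)

lemma pure_reach_trans: "pure_reach m u v \<Longrightarrow> pure_reach m v w \<Longrightarrow> pure_reach m u w"
  unfolding pure_reach_def
proof (elim bexE conjE)
  fix p q assume "p \<in> words (vgens m)" "q \<in> words (vgens m)" "word_perm p = id"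
    "word_perm q = id" "word_act u p = v" "word_act v q = w"
  moreover from this have "word_perm (p @ q) = id"
    by (simp add: word_perm_def fun_eq_iff)
  moreover from calculation have "word_act u (p @ q) = w"
    by (auto simp: word_act_def)
  ultimately show "\<exists>r\<in>words (vgens m). word_perm r = id \<and> word_act u r = w"
    by (intro bexI[of _ "p @ q"]) simp_all
qed

lemma pure_reach_invariants:
  assumes "pure_reach m v w"
  shows "d m w = d m v" and "k \<in> {1..m} \<Longrightarrow> [w k = v k] (mod (2 * d m v))"
  using assms word_act_invariants[of _ m v] unfolding pure_reach_def
  by (blast, metis id_apply)

lemma pure_reach_sym:
  assumes "pure_reach m v w" shows "pure_reach m w v"
proof -
  obtain \<beta> where \<beta>: "\<beta> \<in> VP m" "v \<cdot> \<beta> = w"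
    using assms unfolding pure_reach_iff_VP by blast
  interpret group "VB m" by (rule group_VB)
  have c: "\<beta> \<in> carrier (VB m)" using \<beta>(1) unfolding VP_def by blast
  have "w \<cdot> inv\<^bsub>VB m\<^esub> \<beta> = v"
    using hurwitz_mult[OF c inv_closed[OF c], of v] \<beta>(2) r_inv[OF c] hurwitz_one by metis
  then show ?thesis
    using subgroup.m_inv_closed[OF subgroup_VP \<beta>(1)] unfolding pure_reach_iff_VP by blast
qed

text \<open>Conjugation by \<open>tau l\<close> relabels positions by \<open>s\<close>: the inner
  word acts on \<open>v \<circ> s\<close>, and the last crossing undoes the relabelling.\<close>

lemma pure_reach_conj_tau:
  assumes l: "1 \<le> l" "l < m" and R: "\<And>v. pure_reach m v (v(i := 2 * v j - v i))"
  defines "s \<equiv> transpose l (l + 1)"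
  shows "pure_reach m v (v(s i := 2 * v (s j) - v (s i)))"
proof -
  have act: "letter_act (tau l) a = a \<circ> s" for a
    by (auto simp: s_def fun_eq_iff transpose_def)
  have ss: "s (s k) = k" for k by (simp add: s_def)
  obtain u where u: "u \<in> words (vgens m)" "word_perm u = id"
    "word_act (v \<circ> s) u = (v \<circ> s)(i := 2 * v (s j) - v (s i))"
    using R[of "v \<circ> s"] unfolding pure_reach_def by auto
  have "(v \<circ> s)(i := x) \<circ> s = v(s i := x)" for x
    by (auto simp: fun_eq_iff) (metis ss)+
  then have "word_act v ([tau l] @ u @ [tau l]) = v(s i := 2 * v (s j) - v (s i))"
    using u(3) by (simp add: word_act_def act del: letter_act.simps)
  moreover have "word_perm ([tau l] @ u @ [tau l]) = id"
    using u(2) by (auto simp: word_perm_def fun_eq_iff)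
  moreover have "[tau l] @ u @ [tau l] \<in> words (vgens m)"
    using u(1) l by simp
  ultimately show ?thesis unfolding pure_reach_def by blast
qed

lemma pure_reach_reflect:
  assumes "i \<in> {1..m}" "j \<in> {1..m}" "i \<noteq> j"
  shows "pure_reach m v (v(i := 2 * v j - v i))"
proof -
  \<comment> \<open>Both directions are proved for \<open>i < j\<close>. Neighbours are handled by
    the two orders of \<open>sig i\<close> and \<open>tau i\<close>; conjugation by
    \<open>tau j\<close> then moves the right position from \<open>j\<close> to
    \<open>Suc j\<close>.\<close>
  have "pure_reach m v (v(i := 2 * v j - v i)) \<and> pure_reach m v (v(j := 2 * v i - v j))"
    if "i < j" "1 \<le> i" "j \<le> m" for i j v
    using that
  proof (induction j arbitrary: v)
    case (Suc j)
    show ?case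
    proof (cases "i = j")
      case True
      have "pure_reach m v (v(i := 2 * v (Suc i) - v i))"
        unfolding pure_reach_def using Suc.prems True
        by (intro bexI[of _ "[sig i, tau i]"])
          (auto simp: word_perm_def word_act_def dihedral_op_def)
      moreover have "pure_reach m v (v(Suc i := 2 * v i - v (Suc i)))"
        unfolding pure_reach_def using Suc.prems True
        by (intro bexI[of _ "[tau i, sig i]"])
          (auto simp: word_perm_def word_act_def dihedral_op_def)
      ultimately show ?thesis unfolding True[symmetric] by blast
    next
      case False
      have IH: "pure_reach m v (v(i := 2 * v j - v i))" "pure_reach m v (v(j := 2 * v i - v j))" for v
        using Suc.IH[of v] Suc.prems False by (metis Suc_leD less_SucE)+
      have j: "1 \<le> j" "j < m" "transpose j (j + 1) i = i" "transpose j (j + 1) j = Suc j"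
        using Suc.prems False by (auto simp: transpose_def)
      show ?thesis
        using pure_reach_conj_tau[OF j(1,2) IH(1), of v] pure_reach_conj_tau[OF j(1,2) IH(2), of v]
        unfolding j(3,4) by blast
    qed
  qed simp
  then show ?thesis using assms by (metis atLeastAtMost_iff nat_neq_iff)
qed

text \<open>The entries are reflected one at a time; as \<open>j\<close> lies outside
  \<open>A\<close>, the mirror \<open>v j\<close> never changes.\<close>

lemma pure_reach_reflect_set:
  assumes "finite A" "A \<subseteq> {1..m}" "j \<in> {1..m}" "j \<notin> A"
  shows "pure_reach m v (\<lambda>k. if k \<in> A then 2 * v j - v k else v k)"
  using assms
proof (induction A)
  case (insert i A)
  define w where "w = (\<lambda>k. if k \<in> A then 2 * v j - v k else v k)"
  have "pure_reach m v w" using insert unfolding w_def by auto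
  moreover have "pure_reach m w (w(i := 2 * w j - w i))"
    using insert.prems by (intro pure_reach_reflect) auto
  moreover have "w(i := 2 * w j - w i) = (\<lambda>k. if k \<in> insert i A then 2 * v j - v k else v k)"
    using insert by (auto simp: w_def fun_eq_iff)
  ultimately show ?case by (metis pure_reach_trans)
qed (simp add: pure_reach_refl)

section \<open>Reduction to two values\<close>

text \<open>A value may fail to occur, and \<open>x = y\<close> is allowed;
  \<open>two_valued_d\<close> excludes both when \<open>d m v\<close> is nonzero.\<close>

definition two_valued :: "nat \<Rightarrow> int \<Rightarrow> int \<Rightarrow> (nat \<Rightarrow> int) \<Rightarrow> bool" where
  "two_valued m x y v \<longleftrightarrow> (\<forall>k\<in>{1..m}. v k = x \<or> v k = y)"

lemma pure_reach_two_valued: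
  assumes "\<forall>k\<in>{1..m}. L \<le> v k \<and> v k \<le> L + int n"
  shows "\<exists>w x y. pure_reach m v w \<and> two_valued m x y w"
  using assms
proof (induction n arbitrary: v L)
  case 0
  then show ?case
    by (intro exI[of _ v] exI[of _ L]) (auto simp: pure_reach_refl two_valued_def)
next
  case (Suc n)
  show ?case
  proof (cases "two_valued m L (L + int (Suc n)) v")
    case True
    then show ?thesis using pure_reach_refl by blast
  next
    case False
    then obtain j where j: "j \<in> {1..m}" "v j \<noteq> L" "v j \<noteq> L + int (Suc n)"
      unfolding two_valued_def by blast
    have "\<exists>e L'. pure_reach m v e \<and> (\<forall>k\<in>{1..m}. L' \<le> e k \<and> e k \<le> L' + int n)"
    \<comment> \<open>The test asks whether \<open>v j\<close> is at most as far from
      \<open>L\<close> as from the right end. If so, the entries \<open>L\<close> land strictly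
      above \<open>L\<close> without passing the right end; otherwise the mirror image of this
      happens.\<close>
    proof (cases "2 * v j \<le> 2 * L + int (Suc n)")
      case True
      define A where "A = {k\<in>{1..m}. v k = L}"
      have "pure_reach m v (\<lambda>k. if k \<in> A then 2 * v j - v k else v k)"
        using j by (intro pure_reach_reflect_set) (auto simp: A_def)
      moreover have "\<forall>k\<in>{1..m}. L + 1 \<le> (if k \<in> A then 2 * v j - v k else v k) \<and>
          (if k \<in> A then 2 * v j - v k else v k) \<le> (L + 1) + int n"
        using Suc.prems j True by (force simp: A_def)
      ultimately show ?thesis by blast
    next
      case False
      define A where "A = {k\<in>{1..m}. v k = L + int (Suc n)}"
      have "pure_reach m v (\<lambda>k. if k \<in> A then 2 * v j - v k else v k)"
        using j by (intro pure_reach_reflect_set) (auto simp: A_def)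
      moreover have "\<forall>k\<in>{1..m}. L \<le> (if k \<in> A then 2 * v j - v k else v k) \<and>
          (if k \<in> A then 2 * v j - v k else v k) \<le> L + int n"
        using Suc.prems j False by (force simp: A_def)
      ultimately show ?thesis by blast
    qed
    then show ?thesis using Suc.IH pure_reach_trans by meson
  qed
qed

text \<open>Two unequal entries must be \<open>x\<close> and \<open>y\<close> in some order, and
  every difference is 0 or \<open>x - y\<close> up to sign.\<close>

lemma two_valued_d:
  assumes "two_valued m x y v" "d m v \<noteq> 0"
  shows "d m v = \<bar>x - y\<bar>" and "\<exists>k\<in>{1..m}. v k = x" and "\<exists>k\<in>{1..m}. v k = y"
proof -
  have "\<not> trivial_tuple m v" using assms(2) unfolding d_def by metis
  then obtain i j where ij: "i \<in> {1..m}" "j \<in> {1..m}" "v i \<noteq> v j"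
    unfolding trivial_tuple_def by blast
  with assms(1) have cases: "v i = x \<and> v j = y \<or> v i = y \<and> v j = x"
    unfolding two_valued_def by metis
  then show "\<exists>k\<in>{1..m}. v k = x" "\<exists>k\<in>{1..m}. v k = y" using ij(1,2) by metis+
  have "x - y dvd d m v"
    unfolding dvd_d_iff
  proof (intro ballI)
    fix a b assume "a \<in> {1..m}" "b \<in> {1..m}"
    then have "v a = x \<or> v a = y" "v b = x \<or> v b = y"
      using assms(1) unfolding two_valued_def by blast+
    then show "x - y dvd v a - v b"
      by (elim disjE) (simp_all add: dvd_diff_commute[of _ y x])
  qed
  moreover have "d m v dvd x - y"
    using d_dvd[OF ij(1,2), of v] cases dvd_diff_commute[of "d m v" x y] by metis
  ultimately have "\<bar>d m v\<bar> = \<bar>x - y\<bar>" by (rule zdvd_antisym_abs[rotated])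
  then show "d m v = \<bar>x - y\<bar>" using d_nonneg by simp
qed

lemma pure_reach_two_valued_d:
  assumes "d m v \<noteq> 0"
  shows "\<exists>w L. pure_reach m v w \<and> two_valued m L (L + d m v) w"
proof -
  have fin: "finite (v ` {1..m})" by simp
  define lo hi where "lo = Min (v ` {1..m})" and "hi = Max (v ` {1..m})"
  have "\<forall>k\<in>{1..m}. lo \<le> v k \<and> v k \<le> hi"
    unfolding lo_def hi_def using fin by (meson Max_ge Min_le imageI)
  then have "\<forall>k\<in>{1..m}. lo \<le> v k \<and> v k \<le> lo + int (nat (hi - lo))" by force
  then obtain w x y where w: "pure_reach m v w" "two_valued m x y w"
    using pure_reach_two_valued by blast
  then have d: "d m v = \<bar>x - y\<bar>"
    using two_valued_d(1) pure_reach_invariants(1) assms by metis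
  \<comment> \<open>The order of \<open>x\<close> and \<open>y\<close> is unknown, so the smaller
    one serves as \<open>L\<close>.\<close>
  have "two_valued m (min x y) (min x y + d m v) w"
    using w(2) d unfolding two_valued_def by (auto simp: min_def abs_if)
  then show ?thesis using w(1) by blast
qed

section \<open>Translating the pair of values\<close>

lemma two_valued_commute: "two_valued m x y v \<longleftrightarrow> two_valued m y x v"
  unfolding two_valued_def by metis

text \<open>Reflecting every \<open>x\<close> in a \<open>y\<close> shifts the pair by
  \<open>y - x\<close>: upwards if \<open>x < y\<close>, downwards if \<open>y < x\<close>.\<close>

lemma pure_reach_flip:
  assumes "two_valued m x y v" "d m v \<noteq> 0"
  shows "\<exists>w. pure_reach m v w \<and> two_valued m y (2 * y - x) w"
proof -
  obtain j where j: "j \<in> {1..m}" "v j = y" using two_valued_d(3)[OF assms] by metis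
  have "x \<noteq> y" using two_valued_d(1)[OF assms] assms(2) by simp
  define A where "A = {k\<in>{1..m}. v k = x}"
  define w where "w = (\<lambda>k. if k \<in> A then 2 * v j - v k else v k)"
  have "pure_reach m v w"
    unfolding w_def using j \<open>x \<noteq> y\<close> by (intro pure_reach_reflect_set) (auto simp: A_def)
  moreover have "w k = y \<or> w k = 2 * y - x" if "k \<in> {1..m}" for k
  proof (cases "v k = x")
    case False
    then have "v k = y" using assms(1) that unfolding two_valued_def by metis
    then show ?thesis using False by (simp add: w_def A_def)
  qed (use that j(2) in \<open>simp add: w_def A_def\<close>)
  ultimately show ?thesis unfolding two_valued_def by metis
qed

lemma pure_reach_translate:
  assumes "two_valued m L (L + d m v) v" "d m v \<noteq> 0"
  shows "\<exists>w. pure_reach m v w \<and> two_valued m (L + n * d m v) (L + (n + 1) * d m v) w"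
proof (induction n rule: int_induct[where k = 0])
  case base
  show ?case using assms(1) pure_reach_refl[of m v] by (intro exI[of _ v]) simp
next
  case (step1 n)
  then obtain w where w: "pure_reach m v w"
    "two_valued m (L + n * d m v) (L + (n + 1) * d m v) w" by metis
  have "d m w \<noteq> 0" using assms(2) pure_reach_invariants(1)[OF w(1)] by metis
  from pure_reach_flip[OF w(2) this] w(1) show ?case
    by (auto simp: algebra_simps intro: pure_reach_trans)
next
  case (step2 n)
  \<comment> \<open>The pair is listed with its larger value first when \<open>d m v\<close> is
    positive, so that the flip moves it down.\<close>
  then obtain w where w: "pure_reach m v w"
    "two_valued m (L + (n + 1) * d m v) (L + n * d m v) w" using two_valued_commute by metis
  have "d m w \<noteq> 0" using assms(2) pure_reach_invariants(1)[OF w(1)] by metis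
  from pure_reach_flip[OF w(2) this] w(1) show ?case
    by (auto simp: algebra_simps two_valued_commute intro: pure_reach_trans)
qed

section \<open>From equal invariants to a pure braid\<close>

lemma not_cong_add_half_modulus:
  fixes x e :: int
  assumes "e \<noteq> 0"
  shows "\<not> [x + e = x] (mod (2 * e))"
  using assms dvd_mult_cancel_right[of 2 e 1] by (simp add: cong_iff_dvd_diff)

lemma pure_reach_closed:
  "pure_reach m v w \<Longrightarrow> v \<in> R_inf_pow m \<Longrightarrow> w \<in> R_inf_pow m"
  unfolding pure_reach_def using word_act_closed by blast

lemma pure_reach_if_invariants_eq:
  assumes v: "v \<in> R_inf_pow m" and w: "w \<in> R_inf_pow m"
    and d: "d m v = d m w" and cong: "\<And>k. k \<in> {1..m} \<Longrightarrow> [v k = w k] (mod (2 * d m v))"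
  shows "pure_reach m v w"
proof (cases "d m v = 0")
  case True
  then have "v k = w k" if "k \<in> {1..m}" for k using cong[OF that] by (simp add: cong_0_iff)
  then have "v = w" by (rule PiE_ext[OF v w])
  then show ?thesis using pure_reach_refl by metis
next
  case False
  define e where "e = d m v"
  have e: "e \<noteq> 0" "d m v = e" "d m w = e" using False d by (auto simp: e_def)
  obtain v' L where v': "pure_reach m v v'" "two_valued m L (L + e) v'"
    using pure_reach_two_valued_d[of m v] e by auto
  obtain w' K where w': "pure_reach m w w'" "two_valued m K (K + e) w'"
    using pure_reach_two_valued_d[of m w] e by auto
  have e': "d m v' = e" "d m w' = e"
    using pure_reach_invariants(1) v'(1) w'(1) e by metis+
  \<comment> \<open>Comparing \<open>v'\<close> and \<open>w'\<close> at a position where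
    \<open>v'\<close> equals \<open>L\<close> shows that \<open>L\<close> and \<open>K\<close>
    differ by a multiple of \<open>e\<close>.\<close>
  obtain i where i: "i \<in> {1..m}" "v' i = L" using two_valued_d(2)[OF v'(2)] e e' by auto
  have cong': "[a k = b k] (mod (2 * e))"
    if "pure_reach m v a" "pure_reach m w b" "k \<in> {1..m}" for a b k
    using pure_reach_invariants(2)[OF that(1,3)] pure_reach_invariants(2)[OF that(2,3)]
      cong[OF that(3)] e by (metis cong_sym cong_trans)
  have "2 * e dvd L - w' i"
    using cong'[OF v'(1) w'(1) i(1)] i(2) by (simp add: cong_iff_dvd_diff)
  then have "e dvd L - w' i" by (rule dvd_mult_right)
  then have "e dvd K - L"
  proof -
    have "w' i = K \<or> w' i = K + e" using w'(2) i(1) unfolding two_valued_def by metis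
    moreover have "L - K = (L - (K + e)) + e" by simp
    ultimately have "e dvd L - K"
      using \<open>e dvd L - w' i\<close> dvd_add[OF _ dvd_refl, of e "L - (K + e)"] by metis
    then show ?thesis by (rule dvd_diff_commute[THEN iffD1])
  qed
  then obtain n where "K - L = e * n" by (rule dvdE)
  then have n: "K = L + n * e" by (simp add: algebra_simps)
  have n': "K + e = L + (n + 1) * e" unfolding n by (simp add: algebra_simps)
  then obtain v'' where v'': "pure_reach m v' v''" "two_valued m K (K + e) v''"
    using pure_reach_translate[of m L v' n] v'(2) e(1) unfolding e'(1) n'[symmetric] n[symmetric]
    by metis
  have vv'': "pure_reach m v v''" using v'(1) v''(1) pure_reach_trans by blast
  have "v'' = w'"
  proof (rule PiE_ext[OF pure_reach_closed[OF vv'' v] pure_reach_closed[OF w'(1) w]])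
    fix k assume k: "k \<in> {1..m}"
    \<comment> \<open>Both entries lie in \<open>{K, K + e}\<close>, and these two numbers are
      distinct modulo \<open>2 * e\<close>.\<close>
    show "v'' k = w' k"
      using v''(2) w'(2) k cong'[OF vv'' w'(1) k] not_cong_add_half_modulus[OF e(1), of K] cong_sym
      unfolding two_valued_def by metis
  qed
  then show ?thesis using vv'' w'(1) pure_reach_sym pure_reach_trans by blast
qed

theorem theorem1p4:
  fixes m :: nat and v w :: "nat \<Rightarrow> int"
  assumes "m \<ge> 2" and "v \<in> R_inf_pow m" and "w \<in> R_inf_pow m"
  shows "(\<exists>\<beta>\<in>VP m. v \<cdot> \<beta> = w) \<longleftrightarrow> d m v = d m w \<and> M_star m v = M_star m w"
  unfolding pure_reach_iff_VP[symmetric]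
proof
  assume "pure_reach m v w"
  then show "d m v = d m w \<and> M_star m v = M_star m w"
    using pure_reach_invariants[of m v w] M_star_eq_iff[of m v w] cong_sym by metis
next
  assume "d m v = d m w \<and> M_star m v = M_star m w"
  then show "pure_reach m v w"
    using pure_reach_if_invariants_eq[OF assms(2,3)] M_star_eq_iff[of m v w] by blast
qed

end
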